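(* Assume the Parity conjecture: for every pair of consecutive odd primes $p<q$ with midpoint $m=(p+q)/2$, and for every integer $k$ with $p<k\le m$, the largest multiple of $p$ not exceeding $k^2$ is odd. Then both of the following hold: (1) (Legendre's conjecture) for every positive integer $N$ there is a prime $r$ with $N^2<r<(N+1)^2$; (2) (Andrica's conjecture) for every positive integer $n$, $\sqrt{p_{n+1}}-\sqrt{p_n}<1$, where $p_n$ denotes the $n$-th prime.
   Context: Consecutive odd primes $p<q$ are odd primes with no prime strictly between them; their midpoint $m=(p+q)/2$ is an integer. The primes are listed in increasing order as $p_1=2,p_2=3,p_3=5,\dots$. The Parity conjecture is a hypothesis of the claim, not an established fact. *)

theory Defs
  imports Complex_Main "HOL-Computational_Algebra.Primes" "HOL-Library.Infinite_Set"
begin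

definition consecutive_odd_primes :: "nat \<Rightarrow> nat \<Rightarrow> bool" where
  "consecutive_odd_primes p q \<longleftrightarrow>
     prime p \<and> prime q \<and> odd p \<and> odd q \<and> p < q \<and>
     (\<forall>r. p < r \<and> r < q \<longrightarrow> \<not> prime r)"

definition largest_multiple_upto :: "nat \<Rightarrow> nat \<Rightarrow> nat" where
  "largest_multiple_upto p x = Max {t. p dvd t \<and> t \<le> x}"

text \<open>The division by 2 below is exact, because p and q are odd.\<close>

definition parity_conjecture :: bool where
  "parity_conjecture \<longleftrightarrow>
     (\<forall>p q k. consecutive_odd_primes p q \<and> p < k \<and> k \<le> (p + q) div 2 \<longrightarrow>
        odd (largest_multiple_upto p (k\<^sup>2)))"

text \<open>The library function \<open>enumerate\<close> counts from 0, whereas the primes are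
  numbered from 1, so that \<open>nth_prime 1 = 2\<close>. The value at 0 is a dummy.\<close>

definition nth_prime :: "nat \<Rightarrow> nat" where
  "nth_prime n = enumerate {p. prime p} (n - 1)"

end

theory Submission
  imports Defs
begin

text \<open>
  Write \<open>k = p + j\<close>. The quotient of \<open>k\<^sup>2\<close> by \<open>p\<close> is \<open>p + 2j + \<lfloor>j\<^sup>2/p\<rfloor>\<close>, so for odd \<open>p\<close> the
  largest multiple of \<open>p\<close> up to \<open>k\<^sup>2\<close> is odd iff \<open>\<lfloor>j\<^sup>2/p\<rfloor>\<close> is even. The least \<open>j\<close> with
  \<open>j\<^sup>2 \<ge> p\<close> has \<open>\<lfloor>j\<^sup>2/p\<rfloor> = 1\<close>; hence the conjecture keeps \<open>j = (q - p)/2\<close> below it, that is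
  \<open>((q - p)/2)\<^sup>2 < p\<close>. So \<open>q < p + 2\<surd>p < (\<surd>p + 1)\<^sup>2\<close>, which is Andrica's bound. Legendre's
  conjecture follows by taking for \<open>p\<close> the last prime below \<open>N\<^sup>2\<close>.
\<close>

lemma largest_multiple_upto_eq:
  assumes "p > 0"
  shows "largest_multiple_upto p x = p * (x div p)"
  unfolding largest_multiple_upto_def
proof (rule Max_eqI)
  show "finite {t. p dvd t \<and> t \<le> x}"
    by (rule finite_subset[of _ "{..x}"]) auto
  fix t assume "t \<in> {t. p dvd t \<and> t \<le> x}"
  then obtain c where "t = p * c" "p * c \<le> x" by auto
  with assms show "t \<le> p * (x div p)"
    by (simp add: less_eq_div_iff_mult_less_eq mult.commute)
qed simp

text \<open>For the least \<open>j = i + 1\<close> with \<open>p \<le> j\<^sup>2\<close>, minimality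
  gives \<open>i\<^sup>2 < p\<close>, and the step from \<open>i\<^sup>2\<close> to
  \<open>j\<^sup>2\<close> adds only \<open>2 * i + 1 \<le> p\<close>. The two bounds together force
  the quotient of \<open>j\<^sup>2\<close> by \<open>p\<close> to be exactly 1.\<close>

lemma least_square_above:
  fixes p :: nat
  assumes "p \<ge> 3" "p \<le> h\<^sup>2"
  obtains j where "1 \<le> j" "j \<le> h" "p \<le> j\<^sup>2" "j\<^sup>2 < 2 * p"
proof -
  define j where "j = (LEAST j. p \<le> j\<^sup>2)"
  have j: "p \<le> j\<^sup>2" unfolding j_def by (rule LeastI) (rule assms)
  have "j \<le> h" unfolding j_def by (rule Least_le) (rule assms)
  have "j \<noteq> 0" using j assms by (intro notI) simp
  then obtain i where i: "j = Suc i" by (cases j) auto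
  have "i\<^sup>2 < p"
    using not_less_Least[of i "\<lambda>j. p \<le> j\<^sup>2"] i unfolding j_def by simp
  moreover have "2 * i < p"
  proof (cases "i \<ge> 2")
    case True
    then have "2 * i \<le> i\<^sup>2" by (simp add: power2_eq_square)
    with \<open>i\<^sup>2 < p\<close> show ?thesis by simp
  qed (use assms in auto)
  ultimately have "j\<^sup>2 < 2 * p" by (simp add: i power2_eq_square)
  with that[of j] j \<open>j \<le> h\<close> i show ?thesis by simp
qed

lemma half_gap_square_less:
  assumes "parity_conjecture" "consecutive_odd_primes p q"
  shows "((q - p) div 2)\<^sup>2 < p"
proof (rule ccontr)
  assume "\<not> ?thesis"
  then have h: "p \<le> ((q - p) div 2)\<^sup>2" by simp
  have p: "prime p" "odd p" "p < q"
    using assms(2) by (auto simp: consecutive_odd_primes_def)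
  have "p \<noteq> 2" using p by auto
  then have "p \<ge> 3" using prime_ge_2_nat[OF p(1)] by simp
  then obtain j where j: "1 \<le> j" "j \<le> (q - p) div 2" "p \<le> j\<^sup>2" "j\<^sup>2 < 2 * p"
    using h by (rule least_square_above)
  have "j\<^sup>2 div p = 1"
    using j \<open>p \<ge> 3\<close> by (intro div_nat_eqI) auto
  moreover have "(p + j)\<^sup>2 = p * (p + 2 * j) + j\<^sup>2"
    by (simp add: power2_eq_square algebra_simps)
  ultimately have "(p + j)\<^sup>2 div p = p + 2 * j + 1"
    using \<open>p \<ge> 3\<close> by simp
  \<comment> \<open>As \<open>p\<close> is odd, the cofactor \<open>p + 2 * j + 1\<close> is
    even.\<close>
  then have "even (largest_multiple_upto p ((p + j)\<^sup>2))"
    using p \<open>p \<ge> 3\<close> by (simp add: largest_multiple_upto_eq)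
  moreover have "p < p + j" "p + j \<le> (p + q) div 2" using j p by auto
  ultimately show False
    using assms unfolding parity_conjecture_def by blast
qed

lemma sqrt_consecutive_primes_less:
  assumes "parity_conjecture" "prime p" "prime q" "p < q"
    and gap: "\<And>r. p < r \<Longrightarrow> r < q \<Longrightarrow> \<not> prime r"
  shows "sqrt (real q) < sqrt (real p) + 1"
proof -
  define h where "h = (q - p) div 2"
  have "h\<^sup>2 < p"
  proof (cases "p = 2")
    \<comment> \<open>The conjecture covers odd primes only, so the pair 2, 3 is checked directly;
      there \<open>h = 0\<close>.\<close>
    case True
    then have "q = 3" using gap[of 3] \<open>p < q\<close> by (cases "q = 3") auto
    with True show ?thesis by (simp add: h_def)
  next
    case False
    then have "odd p" "odd q"
      using assms(2-4) prime_odd_nat prime_ge_2_nat by (metis le_neq_implies_less less_trans)+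
    then have "consecutive_odd_primes p q"
      using assms by (auto simp: consecutive_odd_primes_def)
    then show ?thesis unfolding h_def by (rule half_gap_square_less[OF assms(1)])
  qed
  then have "(real h)\<^sup>2 < real p" by (metis of_nat_less_iff of_nat_power)
  then have "real h < sqrt (real p)" by (rule real_less_rsqrt)
  \<comment> \<open>The summand 1 absorbs the rounding in \<open>h\<close>, which occurs for the
    pair 2, 3, and completes the square below.\<close>
  moreover have "q \<le> p + 2 * h + 1" unfolding h_def by linarith
  ultimately have "real q < real p + 2 * sqrt (real p) + 1" by linarith
  also have "\<dots> = (sqrt (real p) + 1)\<^sup>2" by (simp add: power2_eq_square algebra_simps)
  finally show ?thesis by (intro real_less_lsqrt) auto
qed

lemma parity_conjecture_imp_legendre:
  assumes "parity_conjecture" "N \<ge> 1"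
  shows "\<exists>r::nat. prime r \<and> N\<^sup>2 < r \<and> r < (N + 1)\<^sup>2"
proof (cases "N = 1")
  \<comment> \<open>No prime is at most 1, so a last prime up to \<open>N\<^sup>2\<close> exists
    only from \<open>N = 2\<close> on.\<close>
  case True
  then show ?thesis by (intro exI[of _ 2]) (simp add: power2_eq_square)
next
  case False
  with assms have "N \<ge> 2" by simp
  define p where "p = Max {p. prime p \<and> p \<le> N\<^sup>2}"
  define q where "q = (LEAST q. prime q \<and> N\<^sup>2 < q)"
  have fin: "finite {p. prime p \<and> p \<le> N\<^sup>2}"
    by (rule finite_subset[of _ "{..N\<^sup>2}"]) auto
  have "2 \<le> N\<^sup>2" using \<open>N \<ge> 2\<close> by (simp add: power2_eq_square order_trans[OF _ le_square])
  then have "(2::nat) \<in> {p. prime p \<and> p \<le> N\<^sup>2}" by simp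
  then have "p \<in> {p. prime p \<and> p \<le> N\<^sup>2}"
    unfolding p_def by (intro Max_in fin) blast
  then have p: "prime p" "p \<le> N\<^sup>2" by auto
  have q: "prime q \<and> N\<^sup>2 < q"
    unfolding q_def by (rule LeastI_ex) (rule bigger_prime)
  have "\<not> prime r" if "p < r" "r < q" for r
  proof
    assume "prime r"
    show False
    proof (cases "r \<le> N\<^sup>2")
      case True
      then have "r \<le> p" unfolding p_def using \<open>prime r\<close> fin by (intro Max_ge) auto
      with that show False by simp
    next
      case False
      then have "q \<le> r" unfolding q_def using \<open>prime r\<close> by (intro Least_le) auto
      with that show False by simp
    qed
  qed
  then have "sqrt (real q) < sqrt (real p) + 1"
    using assms(1) p q by (intro sqrt_consecutive_primes_less) auto
  \<comment> \<open>Since \<open>p \<le> N\<^sup>2\<close>, a gap below 1 between the roots keeps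
    \<open>sqrt q\<close> below \<open>N + 1\<close>.\<close>
  also have "sqrt (real p) \<le> real N"
    using p(2) by (intro real_le_lsqrt) (auto simp flip: of_nat_power)
  finally have "sqrt (real q) < real (N + 1)" by simp
  then have "real q < (real (N + 1))\<^sup>2"
    by (metis of_nat_0_le_iff real_sqrt_less_iff real_sqrt_unique)
  then have "q < (N + 1)\<^sup>2" by (simp only: of_nat_less_iff flip: of_nat_power)
  with q show ?thesis by blast
qed

lemma parity_conjecture_imp_andrica:
  assumes "parity_conjecture" "n \<ge> 1"
  shows "sqrt (real (nth_prime (n + 1))) - sqrt (real (nth_prime n)) < 1"
proof -
  let ?P = "{p::nat. prime p}"
  have inf: "infinite ?P" by (rule primes_infinite)
  obtain m where m: "n = Suc m" using assms(2) by (cases n) auto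
  \<comment> \<open>Each enumerated prime after the first is the least prime above its
    predecessor.\<close>
  have "\<not> prime r" if "enumerate ?P m < r" "r < enumerate ?P (Suc m)" for r
    using that not_less_Least[of r "\<lambda>s. s \<in> ?P \<and> enumerate ?P m < s"]
    unfolding enumerate_Suc''[OF inf] by auto
  then have "sqrt (real (enumerate ?P (Suc m))) < sqrt (real (enumerate ?P m)) + 1"
    using enumerate_in_set[OF inf] enumerate_step[OF inf] assms(1)
    by (intro sqrt_consecutive_primes_less) auto
  then show ?thesis by (simp add: nth_prime_def m)
qed

theorem mainTheorem1:
  assumes "parity_conjecture"
  shows "(\<forall>N::nat. N \<ge> 1 \<longrightarrow> (\<exists>r::nat. prime r \<and> N\<^sup>2 < r \<and> r < (N + 1)\<^sup>2)) \<and>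
         (\<forall>n::nat. n \<ge> 1 \<longrightarrow>
            sqrt (real (nth_prime (n + 1))) - sqrt (real (nth_prime n)) < 1)"
  using parity_conjecture_imp_legendre[OF assms] parity_conjecture_imp_andrica[OF assms] by blast

end
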